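(* Let $G=(V,E)$ be a finite graph and let $p\in[0,\frac12]$. Let $\omega$ be a random element of $\{0,1\}^E$ with law the random-cluster measure $\phi_{2p,2}$ on $G$ with parameters $2p$ and $q=2$. Conditionally on $\omega$, let $\gamma$ be a uniformly chosen random element of the set of all even subsets of $\eta(\omega)$, i.e. $(V,\gamma)$ is a uniform random even subgraph of $(V,\eta(\omega))$. Then $(V,\gamma)$ is a random even subgraph of $G$ with parameter $p$; that is, $\gamma$ has law $\rho_p$.
   Context: A subset $F\subseteq E$ is called even if every vertex $x\in V$ is incident to an even number of elements of $F$; the subgraph $(V,F)$ is then also called even. $\mathcal E$ denotes the set of all even subsets of $E$. For $p\in[0,1)$ the random even subgraph of $G$ with parameter $p$ is the one with law $\rho_p(F)=\frac1{Z^{\rm E}}p^{|F|}(1-p)^{|E\setminus F|}$, $F\in\mathcal E$, where $Z^{\rm E}=Z^{\rm E}_G(p)$ is the normalizing constant. For $\omega\in\Omega=\{0,1\}^E$, $\eta(\omega)=\{e\in E:\omega(e)=1\}$ is the set of open edges, and $k(\omega)$ is the number of connected components of $(V,\eta(\omega))$ (isolated vertices included). The random-cluster measure on $G$ with parameters $r$ and $q=2$ is $\phi_{r,2}(\omega)=\frac1{Z^{\rm RC}}\,r^{|\eta(\omega)|}(1-r)^{|E\setminus\eta(\omega)|}2^{k(\omega)}$, $\omega\in\Omega$, with $Z^{\rm RC}=Z^{\rm RC}_G(r)$ the normalizing constant; for $r\in\{0,1\}$ the same formula is used with $0^0=1$. *)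

theory Defs
  imports "HOL-Probability.Probability"
begin

text \<open>
  Graphs are finite and undirected, and may have parallel edges and loops: \<open>ends e\<close> is the set of
  endpoints of the edge \<open>e\<close>, a singleton exactly when \<open>e\<close> is a loop. Simple graphs are the special
  case in which \<open>ends\<close> is injective on \<open>E\<close> and every \<open>ends e\<close> has two elements.
\<close>

locale finite_graph =
  fixes V :: "'v set" and E :: "'e set" and ends :: "'e \<Rightarrow> 'v set"
  assumes finite_V: "finite V"
    and finite_E: "finite E"
    and ends_subset: "e \<in> E \<Longrightarrow> ends e \<subseteq> V"
    and card_ends: "e \<in> E \<Longrightarrow> card (ends e) = 1 \<or> card (ends e) = 2"

text \<open>
  As usual a loop counts twice at its vertex, hence the second summand. For loopless graphs this is
  the number of elements of \<open>F\<close> incident to \<open>x\<close>.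
\<close>

definition degree_in :: "('e \<Rightarrow> 'v set) \<Rightarrow> 'e set \<Rightarrow> 'v \<Rightarrow> nat" where
  "degree_in ends F x = card {e \<in> F. x \<in> ends e} + card {e \<in> F. ends e = {x}}"

definition even_subsets :: "'v set \<Rightarrow> 'e set \<Rightarrow> ('e \<Rightarrow> 'v set) \<Rightarrow> 'e set set" where
  "even_subsets V E ends = {F. F \<subseteq> E \<and> (\<forall>x\<in>V. even (degree_in ends F x))}"

definition connected_rel :: "'v set \<Rightarrow> 'e set \<Rightarrow> ('e \<Rightarrow> 'v set) \<Rightarrow> ('v \<times> 'v) set" where
  "connected_rel V E ends = {(x, y). x \<in> V \<and> y \<in> V \<and> (x, y) \<in> {(u, v). \<exists>e\<in>E. ends e = {u, v}}\<^sup>*}"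

definition num_components :: "'v set \<Rightarrow> 'e set \<Rightarrow> ('e \<Rightarrow> 'v set) \<Rightarrow> nat" where
  "num_components V E ends = card (V // connected_rel V E ends)"

text \<open>
  The functions in \<open>{0,1}\<^sup>E\<close> are extensional, that is, \<open>undefined\<close> outside \<open>E\<close>.
\<close>

definition configurations :: "'e set \<Rightarrow> ('e \<Rightarrow> nat) set" where
  "configurations E = E \<rightarrow>\<^sub>E {0, 1}"

definition open_edges :: "'e set \<Rightarrow> ('e \<Rightarrow> nat) \<Rightarrow> 'e set" where
  "open_edges E \<omega> = {e \<in> E. \<omega> e = 1}"

definition even_weight :: "'e set \<Rightarrow> real \<Rightarrow> 'e set \<Rightarrow> real" where
  "even_weight E p F = p ^ card F * (1 - p) ^ card (E - F)"

definition even_Z :: "'v set \<Rightarrow> 'e set \<Rightarrow> ('e \<Rightarrow> 'v set) \<Rightarrow> real \<Rightarrow> real" where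
  "even_Z V E ends p = (\<Sum>F\<in>even_subsets V E ends. even_weight E p F)"

definition random_even_pmf :: "'v set \<Rightarrow> 'e set \<Rightarrow> ('e \<Rightarrow> 'v set) \<Rightarrow> real \<Rightarrow> 'e set pmf" where
  "random_even_pmf V E ends p =
     embed_pmf (\<lambda>F. if F \<in> even_subsets V E ends then even_weight E p F / even_Z V E ends p else 0)"

definition rc_weight :: "'v set \<Rightarrow> 'e set \<Rightarrow> ('e \<Rightarrow> 'v set) \<Rightarrow> real \<Rightarrow> real \<Rightarrow> ('e \<Rightarrow> nat) \<Rightarrow> real" where
  "rc_weight V E ends r q \<omega> =
     r ^ card (open_edges E \<omega>) * (1 - r) ^ card (E - open_edges E \<omega>)
       * q ^ num_components V (open_edges E \<omega>) ends"

definition rc_Z :: "'v set \<Rightarrow> 'e set \<Rightarrow> ('e \<Rightarrow> 'v set) \<Rightarrow> real \<Rightarrow> real \<Rightarrow> real" where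
  "rc_Z V E ends r q = (\<Sum>\<omega>\<in>configurations E. rc_weight V E ends r q \<omega>)"

definition random_cluster_pmf ::
    "'v set \<Rightarrow> 'e set \<Rightarrow> ('e \<Rightarrow> 'v set) \<Rightarrow> real \<Rightarrow> real \<Rightarrow> ('e \<Rightarrow> nat) pmf" where
  "random_cluster_pmf V E ends r q =
     embed_pmf (\<lambda>\<omega>. if \<omega> \<in> configurations E then rc_weight V E ends r q \<omega> / rc_Z V E ends r q else 0)"

text \<open>
  The pmf constructor \<open>embed_pmf\<close> is only meaningful for nonnegative functions of total mass 1;
  the lemmas below show that this holds for the two laws above. Likewise \<open>pmf_of_set\<close> needs a
  finite nonempty set, which \<open>even_subsets V A ends\<close> is for every \<open>A \<subseteq> E\<close>.
\<close>

lemma pmf_embed_finite: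
  fixes w :: "'a \<Rightarrow> real"
  assumes fin: "finite S" and nonneg: "\<And>x. x \<in> S \<Longrightarrow> 0 \<le> w x" and pos: "0 < sum w S"
  shows "pmf (embed_pmf (\<lambda>x. if x \<in> S then w x / sum w S else 0)) x
           = (if x \<in> S then w x / sum w S else 0)"
proof (rule pmf_embed_pmf)
  show "0 \<le> (if x \<in> S then w x / sum w S else 0)" for x
    using nonneg pos by (auto intro: divide_nonneg_pos)
  have "(\<integral>\<^sup>+ x. ennreal (if x \<in> S then w x / sum w S else 0) \<partial>count_space UNIV)
      = (\<integral>\<^sup>+ x. ennreal (w x / sum w S) * indicator S x \<partial>count_space UNIV)"
    by (intro nn_integral_cong) (auto simp: indicator_def)
  also have "\<dots> = (\<integral>\<^sup>+ x. ennreal (w x / sum w S) \<partial>count_space S)"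
    by (subst nn_integral_count_space_indicator) auto
  also have "\<dots> = (\<Sum>x\<in>S. ennreal (w x / sum w S))"
    using fin by (rule nn_integral_count_space_finite)
  also have "\<dots> = ennreal (\<Sum>x\<in>S. w x / sum w S)"
    using nonneg pos by (intro sum_ennreal) (auto intro: divide_nonneg_pos)
  also have "(\<Sum>x\<in>S. w x / sum w S) = 1"
    using pos by (simp flip: sum_divide_distrib)
  finally show "(\<integral>\<^sup>+ x. ennreal (if x \<in> S then w x / sum w S else 0) \<partial>count_space UNIV) = 1"
    by simp
qed

context finite_graph
begin

lemma finite_even_subsets: "A \<subseteq> E \<Longrightarrow> finite (even_subsets V A ends)"
  using finite_E by (auto simp: even_subsets_def intro: finite_subset[of _ "Pow A"] finite_subset[of A E])

lemma empty_in_even_subsets: "{} \<in> even_subsets V A ends"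
  by (simp add: even_subsets_def degree_in_def)

lemma pmf_random_even:
  assumes "0 \<le> p" "p < 1"
  shows "pmf (random_even_pmf V E ends p) F =
    (if F \<in> even_subsets V E ends
     then p ^ card F * (1 - p) ^ card (E - F) / even_Z V E ends p else 0)"
proof -
  have fin: "finite (even_subsets V E ends)"
    by (simp add: finite_even_subsets)
  have nonneg: "0 \<le> even_weight E p F" for F
    using assms by (simp add: even_weight_def)
  have "0 < even_weight E p {}"
    using assms by (simp add: even_weight_def)
  then have "0 < (\<Sum>F\<in>even_subsets V E ends. even_weight E p F)"
    using fin empty_in_even_subsets nonneg by (meson sum_pos2)
  from pmf_embed_finite[OF fin nonneg this] show ?thesis
    unfolding random_even_pmf_def even_Z_def even_weight_def[symmetric] .
qed

lemma pmf_random_cluster: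
  assumes "0 \<le> r" "r \<le> 1" "0 < q"
  shows "pmf (random_cluster_pmf V E ends r q) \<omega> =
    (if \<omega> \<in> configurations E
     then r ^ card (open_edges E \<omega>) * (1 - r) ^ card (E - open_edges E \<omega>)
       * q ^ num_components V (open_edges E \<omega>) ends / rc_Z V E ends r q else 0)"
proof -
  have fin: "finite (configurations E)"
    using finite_E by (auto simp: configurations_def intro: finite_PiE)
  have nonneg: "0 \<le> rc_weight V E ends r q \<omega>" for \<omega>
    using assms by (simp add: rc_weight_def)
  define c :: nat where "c = (if r = 0 then 0 else 1)"
  define w where "w = (\<lambda>e\<in>E. c)"
  have w: "w \<in> configurations E"
    by (auto simp: w_def c_def configurations_def)
  have "open_edges E w = (if r = 0 then {} else E)"
    by (auto simp: open_edges_def w_def c_def)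
  then have "0 < rc_weight V E ends r q w"
    using assms by (simp add: rc_weight_def)
  then have "0 < (\<Sum>\<omega>\<in>configurations E. rc_weight V E ends r q \<omega>)"
    using fin w nonneg by (meson sum_pos2)
  from pmf_embed_finite[OF fin nonneg this] show ?thesis
    unfolding random_cluster_pmf_def rc_Z_def rc_weight_def[symmetric] .
qed

lemma open_edges_subset: "open_edges E \<omega> \<subseteq> E"
  by (auto simp: open_edges_def)

end

end

theory Submission
  imports Defs
begin

text \<open>
  Expanding parity conditions into characters indexed by sets of vertices \<open>S \<subseteq> V\<close>,
  the indicator that \<open>F\<close> is even equals \<open>2^-|V|\<close> times the sum over \<open>S\<close> of \<open>(-1)\<close> to the number
  of edges of \<open>F\<close> that cross the cut defined by \<open>S\<close>. Summing over \<open>F \<subseteq> A\<close> kills every \<open>S\<close> whose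
  cut contains an edge of \<open>A\<close>; the remaining \<open>S\<close> are the unions of components. Hence
  \<open>(V, A)\<close> has \<open>2^(|A| + k(A) - |V|)\<close> even subsets. The factor \<open>2^k(A)\<close> then cancels between the
  random-cluster weight and the uniform choice, leaving a binomial sum over the sets \<open>A \<supseteq> F\<close>.
\<close>

section \<open>Products expanded over subsets\<close>

lemma prod_one_plus:
  fixes f :: "'a \<Rightarrow> 'b::comm_semiring_1"
  assumes "finite A"
  shows "(\<Prod>x\<in>A. 1 + f x) = (\<Sum>B\<in>Pow A. \<Prod>x\<in>B. f x)"
  using prod_add[OF assms, of f "\<lambda>_. 1"] by (simp add: add.commute)

lemma sum_Pow_power_card:
  fixes a b :: "'b::comm_semiring_1"
  assumes "finite A"
  shows "(\<Sum>B\<in>Pow A. a ^ card B * b ^ card (A - B)) = (a + b) ^ card A"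
  using prod_add[OF assms, of "\<lambda>_. a" "\<lambda>_. b"] by simp

section \<open>Parity characters of cuts\<close>

context finite_graph
begin

text \<open>Written through degrees rather than cuts, so that additivity of the degree in the edge
  set turns a product over \<open>F\<close> into a product over the vertices of
  \<open>S\<close>.\<close>

definition crossing_sign :: "'v set \<Rightarrow> 'e \<Rightarrow> int" where
  "crossing_sign S e = (\<Prod>x\<in>S. (-1) ^ degree_in ends {e} x)"

text \<open>Each end in \<open>S\<close> of a non-loop contributes a factor -1, so the sign is
  negative exactly when one of the two ends lies in \<open>S\<close>. A loop has degree 2 at its
  vertex and contributes 1.\<close>

lemma crossing_sign_eq:
  assumes "e \<in> E" "S \<subseteq> V"
  shows "crossing_sign S e = (if ends e \<subseteq> S \<or> ends e \<inter> S = {} then 1 else -1)"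
proof -
  have fS: "finite S" using assms(2) finite_V finite_subset by blast
  have deg: "degree_in ends {e} x = of_bool (x \<in> ends e) + of_bool (ends e = {x})" for x
    by (simp add: degree_in_def Collect_conv_if)
  from card_ends[OF assms(1)] show ?thesis
  proof
    assume "card (ends e) = 1"
    then obtain u where u: "ends e = {u}" by (auto simp: card_1_singleton_iff)
    have "(-1 :: int) ^ degree_in ends {e} x = 1" for x
      by (auto simp: deg u)
    then show ?thesis using u by (auto simp: crossing_sign_def)
  next
    assume "card (ends e) = 2"
    then obtain u v where uv: "ends e = {u, v}" "u \<noteq> v" by (auto simp: card_2_iff)
    have "(-1 :: int) ^ degree_in ends {e} x = (if x = u then -1 else 1) * (if x = v then -1 else 1)" for x
      using uv by (auto simp: deg)
    then show ?thesis using uv fS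
      by (auto simp: crossing_sign_def prod.distrib)
  qed
qed

lemma degree_in_sum:
  assumes "finite F"
  shows "degree_in ends F x = (\<Sum>e\<in>F. degree_in ends {e} x)"
proof -
  have card_eq: "card {e \<in> F. P e} = (\<Sum>e\<in>F. card {e' \<in> {e}. P e'})" for P
  proof -
    have "card {e' \<in> {e}. P e'} = of_bool (P e)" for e
      by (simp add: Collect_conv_if)
    then show ?thesis using assms by (simp add: Int_def)
  qed
  show ?thesis unfolding degree_in_def sum.distrib card_eq[of "\<lambda>e. x \<in> ends e"]
      card_eq[of "\<lambda>e. ends e = {x}"] ..
qed

text \<open>Exchanging the products over \<open>e\<close> and \<open>x\<close> makes the sum over
  \<open>S\<close> factor over the vertices; the factor at \<open>x\<close> is 2 or 0 according to
  the parity of the degree of \<open>x\<close> in \<open>F\<close>.\<close>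

lemma sum_prod_crossing_sign:
  assumes "F \<subseteq> E"
  shows "(\<Sum>S\<in>Pow V. \<Prod>e\<in>F. crossing_sign S e) = (if F \<in> even_subsets V E ends then 2 ^ card V else 0)"
proof -
  have fF: "finite F" using assms finite_E finite_subset by blast
  have "(\<Sum>S\<in>Pow V. \<Prod>e\<in>F. crossing_sign S e) = (\<Sum>S\<in>Pow V. \<Prod>x\<in>S. (-1) ^ degree_in ends F x)"
    unfolding crossing_sign_def degree_in_sum[OF fF] power_sum by (intro sum.cong refl prod.swap)
  also have "\<dots> = (\<Prod>x\<in>V. 1 + (-1) ^ degree_in ends F x)"
    by (rule prod_one_plus[OF finite_V, symmetric])
  also have "\<dots> = (if F \<in> even_subsets V E ends then 2 ^ card V else 0)"
  proof (cases "\<forall>x\<in>V. even (degree_in ends F x)")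
    case True
    then have "(\<Prod>x\<in>V. 1 + (-1) ^ degree_in ends F x) = (\<Prod>x\<in>V. 2 :: int)"
      by (intro prod.cong) auto
    then show ?thesis using True assms by (simp add: even_subsets_def)
  next
    case False
    then obtain x where "x \<in> V" "odd (degree_in ends F x)" by blast
    then have "(\<Prod>x\<in>V. 1 + (-1) ^ degree_in ends F x) = (0 :: int)"
      using finite_V by (intro prod_zero bexI[of _ x]) auto
    then show ?thesis using False by (simp add: even_subsets_def)
  qed
  finally show ?thesis .
qed

section \<open>Unions of connected components\<close>

lemma equiv_connected_rel: "equiv V (connected_rel V A ends)"
proof (rule equivI)
  have "sym {(u, v). \<exists>e\<in>A. ends e = {u, v}}"
    by (auto simp: sym_def insert_commute)
  then have "sym ({(u, v). \<exists>e\<in>A. ends e = {u, v}}\<^sup>*)" by (rule sym_rtrancl)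
  then show "sym (connected_rel V A ends)"
    by (auto simp: connected_rel_def sym_def)
qed (auto simp: connected_rel_def refl_on_def trans_def)

text \<open>Membership in \<open>S\<close> is constant along paths if no edge of \<open>A\<close>
  crosses; conversely, the ends of an edge of \<open>A\<close> are related in both
  directions.\<close>

lemma cut_free_iff:
  assumes "A \<subseteq> E" "S \<subseteq> V"
  shows "(\<forall>e\<in>A. ends e \<subseteq> S \<or> ends e \<inter> S = {})
    \<longleftrightarrow> connected_rel V A ends `` S \<subseteq> S"
proof
  assume free: "\<forall>e\<in>A. ends e \<subseteq> S \<or> ends e \<inter> S = {}"
  have "y \<in> S" if "(x, y) \<in> {(u, v). \<exists>e\<in>A. ends e = {u, v}}\<^sup>*" "x \<in> S" for x y
    using that by (induction) (use free in auto)
  then show "connected_rel V A ends `` S \<subseteq> S"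
    by (auto simp: connected_rel_def)
next
  assume closed: "connected_rel V A ends `` S \<subseteq> S"
  show "\<forall>e\<in>A. ends e \<subseteq> S \<or> ends e \<inter> S = {}"
  proof
    fix e assume e: "e \<in> A"
    with assms have eE: "e \<in> E" by blast
    \<comment> \<open>A loop is the case \<open>u = v\<close>.\<close>
    from card_ends[OF eE] obtain u v where uv: "ends e = {u, v}"
      by (auto simp: card_1_singleton_iff card_2_iff)
    have "(u, v) \<in> connected_rel V A ends" "(v, u) \<in> connected_rel V A ends"
      using ends_subset[OF eE] e uv by (auto simp: connected_rel_def insert_commute intro!: r_into_rtrancl)
    then show "ends e \<subseteq> S \<or> ends e \<inter> S = {}"
      using closed uv by auto
  qed
qed

end

text \<open>Saturated sets are the unions of classes: \<open>Union\<close> and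
  \<open>\<lambda>S. S // R\<close> are inverse bijections between sets of classes and saturated
  sets.\<close>

lemma card_saturated_subsets:
  assumes eq: "equiv V R" and "finite V"
  shows "card {S. S \<subseteq> V \<and> R `` S \<subseteq> S} = 2 ^ card (V // R)"
proof -
  have sub: "\<Union>C \<subseteq> V" if "C \<subseteq> V // R" for C
    using that Union_quotient[OF eq] by blast
  have "bij_betw Union (Pow (V // R)) {S. S \<subseteq> V \<and> R `` S \<subseteq> S}"
  proof (rule bij_betw_byWitness[where f' = "\<lambda>S. S // R"])
    show "\<forall>C\<in>Pow (V // R). \<Union>C // R = C"
    proof (safe)
      fix C X assume C: "C \<subseteq> V // R" and "X \<in> \<Union>C // R"
      then obtain x Y where "x \<in> Y" "Y \<in> C" "X = R `` {x}" by (auto simp: quotient_def)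
      with C eq show "X \<in> C"
        by (metis equiv_class_eq_iff quotientE subsetD Image_singleton_iff)
    next
      fix C X assume C: "C \<subseteq> V // R" and X: "X \<in> C"
      then obtain x where "x \<in> V" "X = R `` {x}" by (auto elim!: quotientE)
      with X show "X \<in> \<Union>C // R"
        using equiv_class_self[OF eq] by (auto intro!: quotientI)
    qed
    show "\<forall>S\<in>{S. S \<subseteq> V \<and> R `` S \<subseteq> S}. \<Union>(S // R) = S"
      using equiv_class_self[OF eq] by (auto simp: quotient_def)
    show "Union ` Pow (V // R) \<subseteq> {S. S \<subseteq> V \<and> R `` S \<subseteq> S}"
      using sub in_quotient_imp_closed[OF eq] by (fastforce simp: subset_iff)
    show "(\<lambda>S. S // R) ` {S. S \<subseteq> V \<and> R `` S \<subseteq> S} \<subseteq> Pow (V // R)"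
      by (auto simp: quotient_def)
  qed
  moreover have "finite (V // R)"
    using assms by (simp add: quotient_def)
  ultimately show ?thesis
    by (simp add: card_Pow flip: bij_betw_same_card)
qed

section \<open>Counting even subsets\<close>

context finite_graph
begin

text \<open>Double counting of the signs over pairs of \<open>F \<subseteq> A\<close> and
  \<open>S \<subseteq> V\<close>. Summing over \<open>S\<close> first gives
  \<open>2 ^ card V\<close> for each even \<open>F\<close>; summing over \<open>F\<close> first
  gives \<open>2 ^ card A\<close> for each saturated \<open>S\<close>. The factor
  \<open>2 ^ card V\<close> stays on the left to avoid subtraction in \<open>nat\<close>.\<close>

lemma card_even_subsets:
  assumes "A \<subseteq> E"
  shows "card (even_subsets V A ends) * 2 ^ card V = 2 ^ (card A + num_components V A ends)"
proof -
  have fA: "finite A" using assms finite_E finite_subset by blast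
  \<comment> \<open>The degree conditions depend on \<open>F\<close> alone, so the parity formula
    for subsets of \<open>E\<close> applies.\<close>
  have even_eq: "even_subsets V A ends = {F \<in> Pow A. F \<in> even_subsets V E ends}"
    using assms by (auto simp: even_subsets_def)
  have prod_cut: "(\<Prod>e\<in>A. 1 + crossing_sign S e)
      = (if connected_rel V A ends `` S \<subseteq> S then 2 ^ card A else 0)" if "S \<subseteq> V" for S
  proof -
    have "1 + crossing_sign S e = (if ends e \<subseteq> S \<or> ends e \<inter> S = {} then 2 else 0)" if "e \<in> A" for e
      using crossing_sign_eq[of e S] \<open>e \<in> A\<close> \<open>S \<subseteq> V\<close> assms by (simp add: subset_iff)
    then have "(\<Prod>e\<in>A. 1 + crossing_sign S e)
        = (\<Prod>e\<in>A. if ends e \<subseteq> S \<or> ends e \<inter> S = {} then 2 else 0)"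
      by (intro prod.cong) auto
    also have "\<dots> = (if \<forall>e\<in>A. ends e \<subseteq> S \<or> ends e \<inter> S = {} then 2 ^ card A else 0)"
      using fA by (auto simp: prod_zero_iff)
    finally show ?thesis unfolding cut_free_iff[OF assms that] .
  qed
  \<comment> \<open>The computation runs in \<open>int\<close> because the signs can be
    negative.\<close>
  have "int (card (even_subsets V A ends) * 2 ^ card V)
      = (\<Sum>F\<in>Pow A. if F \<in> even_subsets V E ends then 2 ^ card V else 0)"
    unfolding even_eq using fA by (simp add: sum.If_cases Int_def)
  also have "\<dots> = (\<Sum>F\<in>Pow A. \<Sum>S\<in>Pow V. \<Prod>e\<in>F. crossing_sign S e)"
    using assms by (intro sum.cong refl sum_prod_crossing_sign[symmetric]) auto
  also have "\<dots> = (\<Sum>S\<in>Pow V. \<Prod>e\<in>A. 1 + crossing_sign S e)"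
    by (subst sum.swap) (simp add: prod_one_plus[OF fA])
  also have "\<dots> = (\<Sum>S\<in>Pow V. if connected_rel V A ends `` S \<subseteq> S then 2 ^ card A else 0)"
    using prod_cut by (intro sum.cong) auto
  also have "\<dots> = 2 ^ card A * int (card {S. S \<subseteq> V \<and> connected_rel V A ends `` S \<subseteq> S})"
    using finite_V by (simp add: sum.If_cases Int_def)
  also have "\<dots> = int (2 ^ (card A + num_components V A ends))"
    using card_saturated_subsets[OF equiv_connected_rel finite_V]
    by (simp add: num_components_def power_add)
  finally show ?thesis by (simp only: of_nat_eq_iff)
qed

section \<open>The law of the uniform even subgraph\<close>

lemma bij_betw_open_edges: "bij_betw (open_edges E) (configurations E) (Pow E)"
\<comment> \<open>The inverse is the indicator of \<open>A\<close> restricted to \<open>E\<close>,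
  as configurations are extensional.\<close>
proof (rule bij_betw_byWitness[where f' = "\<lambda>A. \<lambda>e\<in>E. of_bool (e \<in> A)"])
  show "\<forall>\<omega>\<in>configurations E. (\<lambda>e\<in>E. of_bool (e \<in> open_edges E \<omega>)) = \<omega>"
    by (fastforce simp: configurations_def open_edges_def PiE_def extensional_def Pi_def)
qed (auto simp: configurations_def open_edges_def)

text \<open>Only the sets \<open>A = F \<union> B\<close> with \<open>B \<subseteq> E - F\<close>
  contribute. Each edge outside \<open>F\<close> then carries total weight
  \<open>p + (1 - 2 * p) = 1 - p\<close>, which is where the parameter \<open>2 * p\<close> of the
  random-cluster measure matters.\<close>

lemma even_density_sum:
  fixes p :: real
  assumes F: "F \<in> even_subsets V E ends"
  shows "(\<Sum>A\<in>Pow E. of_bool (F \<in> even_subsets V A ends) * (p ^ card A * (1 - 2 * p) ^ card (E - A)))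
    = even_weight E p F"
proof -
  have FE: "F \<subseteq> E" using F by (simp add: even_subsets_def)
  have fF: "finite F" using FE finite_E finite_subset by blast
  have "(\<Sum>A\<in>Pow E. of_bool (F \<in> even_subsets V A ends) * (p ^ card A * (1 - 2 * p) ^ card (E - A)))
      = (\<Sum>A\<in>{A \<in> Pow E. F \<subseteq> A}. p ^ card A * (1 - 2 * p) ^ card (E - A))"
    using F finite_E by (intro sum.mono_neutral_cong_right) (auto simp: even_subsets_def)
  also have "\<dots> = (\<Sum>B\<in>Pow (E - F). p ^ card F * (p ^ card B * (1 - 2 * p) ^ card ((E - F) - B)))"
  proof (rule sum.reindex_bij_witness[where i = "\<lambda>B. F \<union> B" and j = "\<lambda>A. A - F"])
    fix A assume A: "A \<in> {A \<in> Pow E. F \<subseteq> A}"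
    then have "finite A" using finite_E finite_subset by blast
    with A have "card A = card F + card (A - F)"
      using fF by (metis card_Diff_subset card_mono le_add_diff_inverse mem_Collect_eq)
    moreover have "E - F - (A - F) = E - A" using A by auto
    ultimately show "p ^ card F * (p ^ card (A - F) * (1 - 2 * p) ^ card (E - F - (A - F)))
        = p ^ card A * (1 - 2 * p) ^ card (E - A)"
      by (simp add: power_add)
  qed (use FE in auto)
  also have "\<dots> = even_weight E p F"
    using sum_Pow_power_card[of "E - F" p "1 - 2 * p"] finite_E
    by (simp add: even_weight_def flip: sum_distrib_left)
  finally show ?thesis .
qed

lemma pmf_bind_random_cluster:
  fixes p :: real
  assumes p: "0 \<le> p" "p \<le> 1 / 2"
  shows "pmf (bind_pmf (random_cluster_pmf V E ends (2 * p) 2)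
      (\<lambda>\<omega>. pmf_of_set (even_subsets V (open_edges E \<omega>) ends))) F
    = (if F \<in> even_subsets V E ends
       then 2 ^ card V / rc_Z V E ends (2 * p) 2 * even_weight E p F else 0)"
proof -
  let ?Z = "rc_Z V E ends (2 * p) 2"
  let ?N = "\<lambda>A. real (card (even_subsets V A ends))"
  note pmf_rc = pmf_random_cluster[of "2 * p" 2]
  have fin: "finite (configurations E)"
    using finite_E by (auto simp: configurations_def intro: finite_PiE)
  have uniform: "pmf (pmf_of_set (even_subsets V A ends)) F = of_bool (F \<in> even_subsets V A ends) / ?N A"
    if "A \<subseteq> E" for A
    using finite_even_subsets[OF that] empty_in_even_subsets[of A]
    by (subst pmf_of_set) (auto simp: indicator_def)
  \<comment> \<open>The number of even subsets absorbs both the \<open>2 ^ card A\<close> contained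
    in \<open>(2 * p) ^ card A\<close> and the component factor, leaving a constant independent of
    \<open>A\<close>.\<close>
  have cancel: "(2 * p) ^ card A * (1 - 2 * p) ^ card (E - A) * 2 ^ num_components V A ends / ?N A
      = 2 ^ card V * (p ^ card A * (1 - 2 * p) ^ card (E - A))" if "A \<subseteq> E" for A
  proof -
    have "?N A * 2 ^ card V = 2 ^ card A * 2 ^ num_components V A ends"
      using arg_cong[OF card_even_subsets[OF that], of real] by (simp add: power_add)
    moreover have "?N A \<noteq> 0"
      using finite_even_subsets[OF that] empty_in_even_subsets[of A] by auto
    ultimately show ?thesis by (simp add: field_simps)
  qed
  have "pmf (bind_pmf (random_cluster_pmf V E ends (2 * p) 2)
      (\<lambda>\<omega>. pmf_of_set (even_subsets V (open_edges E \<omega>) ends))) F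
    = (\<Sum>\<omega>\<in>configurations E. pmf (pmf_of_set (even_subsets V (open_edges E \<omega>) ends)) F
        * pmf (random_cluster_pmf V E ends (2 * p) 2) \<omega>)"
    unfolding pmf_bind using p
    by (intro integral_measure_pmf_real[OF fin]) (auto simp: set_pmf_iff pmf_rc split: if_splits)
  also have "\<dots> = (\<Sum>\<omega>\<in>configurations E. (\<lambda>A. pmf (pmf_of_set (even_subsets V A ends)) F
        * ((2 * p) ^ card A * (1 - 2 * p) ^ card (E - A) * 2 ^ num_components V A ends / ?Z))
        (open_edges E \<omega>))"
    using p by (intro sum.cong) (auto simp: pmf_rc)
  also have "\<dots> = (\<Sum>A\<in>Pow E. pmf (pmf_of_set (even_subsets V A ends)) F
        * ((2 * p) ^ card A * (1 - 2 * p) ^ card (E - A) * 2 ^ num_components V A ends / ?Z))"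
    by (rule sum.reindex_bij_betw[OF bij_betw_open_edges])
  also have "\<dots> = (\<Sum>A\<in>Pow E. 2 ^ card V / ?Z
      * (of_bool (F \<in> even_subsets V A ends) * (p ^ card A * (1 - 2 * p) ^ card (E - A))))"
  proof (rule sum.cong[OF refl])
    fix A assume "A \<in> Pow E"
    then have A: "A \<subseteq> E" by simp
    have "pmf (pmf_of_set (even_subsets V A ends)) F
        * ((2 * p) ^ card A * (1 - 2 * p) ^ card (E - A) * 2 ^ num_components V A ends / ?Z)
      = of_bool (F \<in> even_subsets V A ends) / ?Z
        * ((2 * p) ^ card A * (1 - 2 * p) ^ card (E - A) * 2 ^ num_components V A ends / ?N A)"
      by (simp add: uniform[OF A])
    also have "\<dots> = 2 ^ card V / ?Z
        * (of_bool (F \<in> even_subsets V A ends) * (p ^ card A * (1 - 2 * p) ^ card (E - A)))"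
      unfolding cancel[OF A] by simp
    finally show "pmf (pmf_of_set (even_subsets V A ends)) F
        * ((2 * p) ^ card A * (1 - 2 * p) ^ card (E - A) * 2 ^ num_components V A ends / ?Z)
      = 2 ^ card V / ?Z
        * (of_bool (F \<in> even_subsets V A ends) * (p ^ card A * (1 - 2 * p) ^ card (E - A)))" .
  qed
  also have "\<dots> = 2 ^ card V / ?Z
      * (\<Sum>A\<in>Pow E. of_bool (F \<in> even_subsets V A ends) * (p ^ card A * (1 - 2 * p) ^ card (E - A)))"
    by (rule sum_distrib_left[symmetric])
  also have "\<dots> = (if F \<in> even_subsets V E ends then 2 ^ card V / ?Z * even_weight E p F else 0)"
  proof (cases "F \<in> even_subsets V E ends")
    case True
    then show ?thesis by (simp add: even_density_sum)
  next
    case False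
    \<comment> \<open>An even subset of a smaller edge set is also an even subset of
      \<open>E\<close>, so every summand vanishes.\<close>
    then have "F \<notin> even_subsets V A ends" if "A \<subseteq> E" for A
      using that by (auto simp: even_subsets_def)
    then show ?thesis using False by (auto intro!: sum.neutral)
  qed
  finally show ?thesis .
qed

end

section \<open>Comparison of normalizing constants\<close>

lemma pmf_eq_if_proportional:
  fixes c :: real
  assumes "\<And>x. pmf P x = c * pmf Q x"
  shows "P = Q"
proof -
  \<comment> \<open>Comparing total masses forces \<open>c = 1\<close>, so neither partition
    function has to be evaluated. Nonnegativity of \<open>c\<close> allows it to be moved through
    \<open>ennreal\<close>; it is read off at a point of the support of \<open>Q\<close>.\<close>
  have "emeasure P UNIV = ennreal c * emeasure Q UNIV" if "0 \<le> c"
    using assms that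
    by (simp add: emeasure_pmf nn_integral_pmf[symmetric] ennreal_mult nn_integral_cmult)
  moreover have "0 \<le> c"
  proof -
    obtain x where "x \<in> set_pmf Q" using set_pmf_not_empty by fast
    then have "0 < pmf Q x" by (simp add: pmf_positive)
    with assms[of x] show ?thesis by (metis pmf_nonneg zero_le_mult_iff not_less)
  qed
  ultimately have "c = 1" by (simp add: emeasure_pmf)
  then show ?thesis using assms by (intro pmf_eqI) simp
qed

theorem theorem3p1:
  fixes V :: "'v set" and E :: "'e set" and ends :: "'e \<Rightarrow> 'v set" and p :: real
  assumes "finite_graph V E ends"
    and "0 \<le> p" and "p \<le> 1 / 2"
  shows "bind_pmf (random_cluster_pmf V E ends (2 * p) 2)
           (\<lambda>\<omega>. pmf_of_set (even_subsets V (open_edges E \<omega>) ends))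
         = random_even_pmf V E ends p"
proof -
  interpret finite_graph V E ends by fact
  \<comment> \<open>With division by zero equal to 0, a vanishing constant would make every point
    mass 0 and the support empty.\<close>
  have "even_Z V E ends p \<noteq> 0"
  proof
    assume "even_Z V E ends p = 0"
    then have "set_pmf (random_even_pmf V E ends p) = {}"
      using assms(2,3) by (auto simp: set_pmf_eq pmf_random_even)
    then show False by (simp add: set_pmf_not_empty)
  qed
  \<comment> \<open>The factor \<open>even_Z\<close> in \<open>c\<close> undoes the normalization of
    the even law; the rest of \<open>c\<close> is the constant found for the mixture.\<close>
  then show ?thesis using assms(2,3)
    by (intro pmf_eq_if_proportional[where c = "2 ^ card V / rc_Z V E ends (2 * p) 2 * even_Z V E ends p"])
       (simp add: pmf_bind_random_cluster pmf_random_even even_weight_def)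
qed

end
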